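(* For every positive integer $k$, the class of graphs with tree-independence number at most $k$ is $(\mathrm{tw},\omega)$-bounded, with a $(\mathrm{tw},\omega)$-binding function $f(p) = R(p+1,k+1)-2$, and this function $f$ is upper-bounded by a polynomial in $p$ of degree $k$.
   Context: All graphs are finite, simple, and undirected. A tree decomposition of a graph $G$ is a pair $\mathcal{T}=(T,\{X_t\}_{t\in V(T)})$ where $T$ is a tree and each node $t$ is assigned a set (bag) $X_t\subseteq V(G)$ such that every vertex of $G$ is in at least one bag, every edge of $G$ has both endpoints in some common bag, and for every $u\in V(G)$ the subgraph of $T$ induced by $\{t: u\in X_t\}$ is connected. Its width is $\max_t |X_t|-1$, and the treewidth $\mathrm{tw}(G)$ is the minimum width of a tree decomposition of $G$. The independence number of $\mathcal{T}$ is $\alpha(\mathcal{T})=\max_{t\in V(T)}\alpha(G[X_t])$, where $\alpha(H)$ is the maximum size of an independent set in $H$. The tree-independence number $\mathsf{tree}\text{-}\alpha(G)$ is the minimum of $\alpha(\mathcal{T})$ over all tree decompositions $\mathcal{T}$ of $G$. The clique number of $G$ is denoted $\omega(G)$. A graph class $\mathcal{G}$ is $(\mathrm{tw},\omega)$-bounded if it admits a $(\mathrm{tw},\omega)$-binding function, that is, a function $f$ such that for every $G\in\mathcal{G}$ and every induced subgraph $G'$ of $G$ we have $\mathrm{tw}(G')\le f(\omega(G'))$. For positive integers $p,q$, the Ramsey number $R(p,q)$ is the least positive integer $N$ such that every graph with at least $N$ vertices contains a clique of size $p$ or an independent set of size $q$. *)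

theory Defs
  imports "Graph_Theory.Graph_Theory" "HOL-Computational_Algebra.Polynomial"
begin

text \<open>
  Finite simple undirected graphs are the symmetric, loop-free digraphs without parallel arcs of the
  locale \<^locale>\<open>graph\<close> (respectively \<^locale>\<open>pair_graph\<close>): an undirected edge is a pair of
  opposite arcs. The null graph is admitted.
\<close>

definition clique_in :: "('a, 'b) pre_digraph \<Rightarrow> 'a set \<Rightarrow> bool" where
  "clique_in G S \<longleftrightarrow> S \<subseteq> verts G \<and> (\<forall>u\<in>S. \<forall>v\<in>S. u \<noteq> v \<longrightarrow> u \<rightarrow>\<^bsub>G\<^esub> v)"

definition independent_in :: "('a, 'b) pre_digraph \<Rightarrow> 'a set \<Rightarrow> bool" where
  "independent_in G S \<longleftrightarrow> S \<subseteq> verts G \<and> (\<forall>u\<in>S. \<forall>v\<in>S. \<not> u \<rightarrow>\<^bsub>G\<^esub> v)"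

definition clique_number :: "('a, 'b) pre_digraph \<Rightarrow> nat" where
  "clique_number G = Max {card S | S. clique_in G S}"

definition independence_number :: "('a, 'b) pre_digraph \<Rightarrow> nat" where
  "independence_number G = Max {card S | S. independent_in G S}"

text \<open>
  The library's \<^const>\<open>tree\<close> cannot be used: in a symmetric digraph every edge gives a directed cycle
  of length 2. The cycles of an undirected simple graph are the directed ones of length at least 3.
  \<^const>\<open>Digraph_Component.connected\<close> includes non-emptiness.
\<close>

definition undirected_tree :: "'a pair_pre_digraph \<Rightarrow> bool" where
  "undirected_tree T \<longleftrightarrow> pair_graph T \<and> Digraph_Component.connected T \<and>
     \<not> (\<exists>c. pre_digraph.cycle T c \<and> 3 \<le> length c)"

text \<open>
  Since trees are finite, it is no restriction to take natural numbers as their nodes.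
\<close>

definition tree_decomposition ::
  "('a, 'b) pre_digraph \<Rightarrow> nat pair_pre_digraph \<Rightarrow> (nat \<Rightarrow> 'a set) \<Rightarrow> bool" where
  "tree_decomposition G T X \<longleftrightarrow>
     undirected_tree T \<and>
     (\<forall>t\<in>pverts T. X t \<subseteq> verts G) \<and>
     (\<forall>u\<in>verts G. \<exists>t\<in>pverts T. u \<in> X t) \<and>
     (\<forall>u v. u \<rightarrow>\<^bsub>G\<^esub> v \<longrightarrow> (\<exists>t\<in>pverts T. u \<in> X t \<and> v \<in> X t)) \<and>
     (\<forall>u\<in>verts G. Digraph_Component.connected (with_proj T \<restriction> {t \<in> pverts T. u \<in> X t}))"

text \<open>
  Widths are integers, so that the null graph has treewidth \<open>-1\<close>.
\<close>

definition td_width :: "nat pair_pre_digraph \<Rightarrow> (nat \<Rightarrow> 'a set) \<Rightarrow> int" where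
  "td_width T X = int (Max ((\<lambda>t. card (X t)) ` pverts T)) - 1"

definition treewidth :: "('a, 'b) pre_digraph \<Rightarrow> int" where
  "treewidth G = Min {td_width T X | T X. tree_decomposition G T X}"

definition td_independence_number ::
  "('a, 'b) pre_digraph \<Rightarrow> nat pair_pre_digraph \<Rightarrow> (nat \<Rightarrow> 'a set) \<Rightarrow> nat" where
  "td_independence_number G T X = Max ((\<lambda>t. independence_number (G \<restriction> X t)) ` pverts T)"

definition tree_independence_number :: "('a, 'b) pre_digraph \<Rightarrow> nat" where
  "tree_independence_number G =
     Min {td_independence_number G T X | T X. tree_decomposition G T X}"

definition tw_omega_binding_function ::
  "('a, 'b) pre_digraph set \<Rightarrow> (nat \<Rightarrow> int) \<Rightarrow> bool" where
  "tw_omega_binding_function \<G> f \<longleftrightarrow>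
     (\<forall>G\<in>\<G>. \<forall>G'. induced_subgraph G' G \<longrightarrow> treewidth G' \<le> f (clique_number G'))"

definition tw_omega_bounded :: "('a, 'b) pre_digraph set \<Rightarrow> bool" where
  "tw_omega_bounded \<G> \<longleftrightarrow> (\<exists>f. tw_omega_binding_function \<G> f)"

text \<open>
  Every finite graph is isomorphic to one whose vertices are natural numbers.
\<close>

definition ramsey_number :: "nat \<Rightarrow> nat \<Rightarrow> nat" where
  "ramsey_number p q = (LEAST N. 0 < N \<and>
     (\<forall>G :: nat pair_pre_digraph. pair_graph G \<and> N \<le> card (pverts G) \<longrightarrow>
        (\<exists>S. clique_in G S \<and> card S = p) \<or> (\<exists>S. independent_in G S \<and> card S = q)))"

end

theory Submission
  imports Defs
begin

text \<open>
  Deleting vertices from the bags of a tree decomposition shows that the tree-independence number is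
  monotone under induced subgraphs, so it suffices to bound the treewidth of \<open>G\<close> itself. Every bag of
  a tree decomposition of \<open>G\<close> with independence number at most \<open>k\<close> induces a graph without cliques of
  size \<open>\<omega> + 1\<close> and without independent sets of size \<open>k + 1\<close>, hence has fewer than
  \<open>R (\<omega> + 1) (k + 1)\<close> vertices. The polynomial bound is the Erdos--Szekeres estimate
  \<open>R (p + 1) (k + 1) \<le> (p + k choose k) \<le> (p + k) ^ k\<close>.
\<close>

section \<open>Cliques and independent sets\<close>

lemma clique_in_empty [simp]: "clique_in G {}"
  by (simp add: clique_in_def)

lemma independent_in_empty [simp]: "independent_in G {}"
  by (simp add: independent_in_def)

lemma (in sym_digraph) clique_in_insert:
  assumes "clique_in G S" "x \<in> verts G" "\<And>v. v \<in> S \<Longrightarrow> x \<rightarrow>\<^bsub>G\<^esub> v"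
  shows "clique_in G (insert x S)"
  using assms graph_symmetric[OF assms(3)] by (auto simp: clique_in_def)

lemma (in sym_digraph) independent_in_insert:
  assumes "independent_in G S" "x \<in> verts G" "\<not> x \<rightarrow>\<^bsub>G\<^esub> x" "\<And>v. v \<in> S \<Longrightarrow> \<not> x \<rightarrow>\<^bsub>G\<^esub> v"
  shows "independent_in G (insert x S)"
proof -
  have "\<not> v \<rightarrow>\<^bsub>G\<^esub> x" if "v \<in> S" for v
    using assms(4)[OF that] graph_symmetric by blast
  with assms show ?thesis
    by (auto simp: independent_in_def)
qed

lemma induced_subgraph_dominates_iff:
  assumes "induced_subgraph H G"
  shows "u \<rightarrow>\<^bsub>H\<^esub> v \<longleftrightarrow> u \<rightarrow>\<^bsub>G\<^esub> v \<and> u \<in> verts H \<and> v \<in> verts H"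
  using assms by (auto simp: induced_subgraph_def subgraph_def compatible_def arcs_ends_conv)

lemma induced_subgraph_imp_subverts:
  assumes "induced_subgraph H G"
  shows "verts H \<subseteq> verts G"
  using assms by (intro subgraph_imp_subverts induced_imp_subgraph)

lemma clique_in_induced_subgraph_iff:
  assumes "induced_subgraph H G"
  shows "clique_in H S \<longleftrightarrow> clique_in G S \<and> S \<subseteq> verts H"
  using induced_subgraph_imp_subverts[OF assms]
  unfolding clique_in_def induced_subgraph_dominates_iff[OF assms] by blast

lemma independent_in_induced_subgraph_iff:
  assumes "induced_subgraph H G"
  shows "independent_in H S \<longleftrightarrow> independent_in G S \<and> S \<subseteq> verts H"
  using induced_subgraph_imp_subverts[OF assms]
  unfolding independent_in_def induced_subgraph_dominates_iff[OF assms] by blast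

lemma induced_subgraph_induce_Int:
  assumes "induced_subgraph H G"
  shows "induced_subgraph (H \<restriction> (S \<inter> verts H)) (G \<restriction> S)"
  using assms
  by (auto simp: induced_subgraph_def subgraph_def compatible_def
      wf_digraph.wellformed_induce_subgraph)

lemma (in graph) graphI_induced:
  assumes "induced_subgraph H G"
  shows "graph H"
proof -
  interpret H: digraph H
    using assms by (rule digraphI_induced)
  show ?thesis
    by (rule H.graphI[OF induced_graph_imp_symmetric[OF sym_arcs assms]])
qed

lemma Max_card_le_iff:
  assumes "finite V" and "P {}" and "\<And>S. P S \<Longrightarrow> S \<subseteq> V"
  shows "Max {card S | S. P S} \<le> n \<longleftrightarrow> (\<forall>S. P S \<longrightarrow> card S \<le> n)"
proof -
  have "finite {S. P S}"
    by (rule finite_subset[of _ "Pow V"]) (use assms in auto)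
  then show ?thesis
    unfolding setcompr_eq_image using \<open>P {}\<close> by (subst Max_le_iff) auto
qed

lemma clique_number_le_iff:
  assumes "finite (verts G)"
  shows "clique_number G \<le> n \<longleftrightarrow> (\<forall>S. clique_in G S \<longrightarrow> card S \<le> n)"
  unfolding clique_number_def using assms
  by (rule Max_card_le_iff) (auto simp: clique_in_def)

lemma card_le_clique_number:
  assumes "finite (verts G)" and "clique_in G S"
  shows "card S \<le> clique_number G"
  using clique_number_le_iff[OF assms(1), of "clique_number G"] assms(2) by simp

lemma independence_number_le_iff:
  assumes "finite (verts G)"
  shows "independence_number G \<le> n \<longleftrightarrow> (\<forall>S. independent_in G S \<longrightarrow> card S \<le> n)"
  unfolding independence_number_def using assms
  by (rule Max_card_le_iff) (auto simp: independent_in_def)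

lemma card_le_independence_number:
  assumes "finite (verts G)" and "independent_in G S"
  shows "card S \<le> independence_number G"
  using independence_number_le_iff[OF assms(1), of "independence_number G"] assms(2) by simp

lemma clique_number_induced_subgraph_le:
  assumes "finite (verts G)" and induced: "induced_subgraph H G"
  shows "clique_number H \<le> clique_number G"
proof -
  have "finite (verts H)"
    using induced_subgraph_imp_subverts[OF induced] assms(1) by (rule finite_subset)
  then show ?thesis
    using card_le_clique_number[OF assms(1)]
    by (simp add: clique_number_le_iff clique_in_induced_subgraph_iff[OF induced])
qed

lemma independence_number_induced_subgraph_le:
  assumes "finite (verts G)" and induced: "induced_subgraph H G"
  shows "independence_number H \<le> independence_number G"
proof -
  have "finite (verts H)"
    using induced_subgraph_imp_subverts[OF induced] assms(1) by (rule finite_subset)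
  then show ?thesis
    using card_le_independence_number[OF assms(1)]
    by (simp add: independence_number_le_iff independent_in_induced_subgraph_iff[OF induced])
qed

lemma independence_number_le_card:
  assumes "finite (verts G)"
  shows "independence_number G \<le> card (verts G)"
  using assms by (auto simp: independence_number_le_iff independent_in_def intro: card_mono)

section \<open>Ramsey numbers\<close>

definition has_clique_or_independent :: "('a, 'b) pre_digraph \<Rightarrow> nat \<Rightarrow> nat \<Rightarrow> bool" where
  "has_clique_or_independent G p q \<longleftrightarrow>
     (\<exists>S. clique_in G S \<and> card S = p) \<or> (\<exists>S. independent_in G S \<and> card S = q)"

lemma has_clique_or_independent_zero:
  assumes "p = 0 \<or> q = 0"
  shows "has_clique_or_independent G p q"
  using assms clique_in_empty independent_in_empty card.empty
  unfolding has_clique_or_independent_def by metis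

lemma (in loopfree_digraph) has_clique_or_independent_one:
  assumes "x \<in> verts G" and "p = 1 \<or> q = 1"
  shows "has_clique_or_independent G p q"
proof -
  have "clique_in G {x}" "independent_in G {x}"
    using assms(1) no_loops by (auto simp: clique_in_def independent_in_def arcs_ends_conv)
  moreover have "card {x} = 1"
    by simp
  ultimately show ?thesis
    using assms(2) unfolding has_clique_or_independent_def by metis
qed

definition neighbors :: "('a, 'b) pre_digraph \<Rightarrow> 'a \<Rightarrow> 'a set" where
  "neighbors G x = {v. x \<rightarrow>\<^bsub>G\<^esub> v}"

definition nonneighbors :: "('a, 'b) pre_digraph \<Rightarrow> 'a \<Rightarrow> 'a set" where
  "nonneighbors G x = verts G - insert x (neighbors G x)"

lemma (in wf_digraph) neighbors_subset_verts: "neighbors G x \<subseteq> verts G"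
  by (auto simp: neighbors_def)

lemma nonneighbors_subset_verts: "nonneighbors G x \<subseteq> verts G"
  by (auto simp: nonneighbors_def)

lemma (in loopfree_digraph) not_in_neighbors: "x \<notin> neighbors G x"
  using no_loops by (auto simp: neighbors_def arcs_ends_conv)

lemma (in digraph) card_verts_eq_neighbors_nonneighbors:
  assumes "x \<in> verts G"
  shows "card (verts G) = 1 + card (neighbors G x) + card (nonneighbors G x)"
proof -
  have "insert x (neighbors G x) \<subseteq> verts G"
    using assms neighbors_subset_verts by simp
  moreover have "card (insert x (neighbors G x)) = 1 + card (neighbors G x)"
    using not_in_neighbors finite_subset[OF neighbors_subset_verts finite_verts] by simp
  ultimately show ?thesis
    unfolding nonneighbors_def by (metis card_Int_Diff finite_verts inf.absorb_iff2)
qed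

lemma (in digraph) binomial_le_card_neighbors_or_nonneighbors:
  assumes "x \<in> verts G" and "(a + b + 2) choose (a + 1) \<le> card (verts G)"
  shows "(a + b + 1) choose a \<le> card (neighbors G x) \<or>
    (a + b + 1) choose (a + 1) \<le> card (nonneighbors G x)"
proof -
  have "(a + b + 2) choose (a + 1) = ((a + b + 1) choose a) + ((a + b + 1) choose (a + 1))"
    by simp
  then show ?thesis
    using assms(2) card_verts_eq_neighbors_nonneighbors[OF assms(1)] by linarith
qed

lemma (in graph) has_clique_or_independent_neighborsD:
  assumes x_vert: "x \<in> verts G" and "has_clique_or_independent (G \<restriction> neighbors G x) p q"
  shows "has_clique_or_independent G (p + 1) q"
proof -
  have induced: "induced_subgraph (G \<restriction> neighbors G x) G"
    by (rule induced_induce[OF neighbors_subset_verts])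
  from assms(2) consider (clique) S where "S \<subseteq> neighbors G x" "clique_in G S" "card S = p"
    | (independent) S where "independent_in G S" "card S = q"
    by (auto simp: has_clique_or_independent_def clique_in_induced_subgraph_iff[OF induced]
        independent_in_induced_subgraph_iff[OF induced])
  then show ?thesis
  proof cases
    case clique
    have "finite S" "x \<notin> S"
      using clique not_in_neighbors finite_subset[OF _ finite_verts] by (auto simp: clique_in_def)
    then have "card (insert x S) = p + 1"
      using clique(3) by simp
    moreover have "clique_in G (insert x S)"
      using clique x_vert by (intro clique_in_insert) (auto simp: neighbors_def)
    ultimately show ?thesis
      unfolding has_clique_or_independent_def by blast
  next
    case independent
    then show ?thesis
      unfolding has_clique_or_independent_def by blast
  qed
qed

lemma (in graph) has_clique_or_independent_nonneighborsD:
  assumes x_vert: "x \<in> verts G" and "has_clique_or_independent (G \<restriction> nonneighbors G x) p q"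
  shows "has_clique_or_independent G p (q + 1)"
proof -
  have induced: "induced_subgraph (G \<restriction> nonneighbors G x) G"
    by (rule induced_induce[OF nonneighbors_subset_verts])
  from assms(2) consider (clique) S where "clique_in G S" "card S = p"
    | (independent) S where "S \<subseteq> nonneighbors G x" "independent_in G S" "card S = q"
    by (auto simp: has_clique_or_independent_def clique_in_induced_subgraph_iff[OF induced]
        independent_in_induced_subgraph_iff[OF induced])
  then show ?thesis
  proof cases
    case clique
    then show ?thesis
      unfolding has_clique_or_independent_def by blast
  next
    case independent
    have "finite S" "x \<notin> S"
      using independent finite_subset[OF _ finite_verts]
      by (auto simp: independent_in_def nonneighbors_def)
    then have "card (insert x S) = q + 1"
      using independent(3) by simp
    moreover have "independent_in G (insert x S)"
      using independent x_vert not_in_neighbors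
      by (intro independent_in_insert) (auto simp: neighbors_def nonneighbors_def)
    ultimately show ?thesis
      unfolding has_clique_or_independent_def by blast
  qed
qed

text \<open>
  The bound \<open>p + q choose p\<close> of \<open>HOL-Library.Ramsey\<close> would only give a polynomial of degree \<open>k + 1\<close>
  in the theorem.
\<close>

lemma erdos_szekeres:
  assumes "graph G" and "(p + q - 2) choose (p - 1) \<le> card (verts G)"
  shows "has_clique_or_independent G p q"
  using assms
proof (induction "p + q" arbitrary: p q G rule: less_induct)
  case less
  interpret graph G by fact
  show ?case
  proof (cases "p = 0 \<or> q = 0")
    case True
    then show ?thesis by (rule has_clique_or_independent_zero)
  next
    case nonzero: False
    then have "0 < card (verts G)"
      using less.prems(2) by (intro less_le_trans[OF zero_less_binomial]) auto
    then obtain x where x_vert: "x \<in> verts G"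
      by fastforce
    show ?thesis
    proof (cases "p = 1 \<or> q = 1")
      case True
      with x_vert show ?thesis by (rule has_clique_or_independent_one)
    next
      case False
      with nonzero obtain a b where pq: "p = (a + 1) + 1" "q = (b + 1) + 1"
        by (metis Suc_eq_plus1 not0_implies_Suc One_nat_def)
      have "(a + b + 2) choose (a + 1) \<le> card (verts G)"
        using less.prems(2) by (simp add: pq)
      from binomial_le_card_neighbors_or_nonneighbors[OF x_vert this]
      consider (neighbors) "(a + b + 1) choose a \<le> card (neighbors G x)"
        | (nonneighbors) "(a + b + 1) choose (a + 1) \<le> card (nonneighbors G x)"
        by blast
      then show ?thesis
      proof cases
        case neighbors
        then have "has_clique_or_independent (G \<restriction> neighbors G x) (a + 1) q"
          by (intro less.hyps graphI_induced induced_induce neighbors_subset_verts)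
            (simp_all add: pq)
        then show ?thesis
          unfolding pq(1) by (rule has_clique_or_independent_neighborsD[OF x_vert])
      next
        case nonneighbors
        then have "has_clique_or_independent (G \<restriction> nonneighbors G x) p (b + 1)"
          by (intro less.hyps graphI_induced induced_induce nonneighbors_subset_verts)
            (simp_all add: pq)
        then show ?thesis
          unfolding pq(2) by (rule has_clique_or_independent_nonneighborsD[OF x_vert])
      qed
    qed
  qed
qed

definition forces_clique_or_independent :: "nat \<Rightarrow> nat \<Rightarrow> nat \<Rightarrow> bool" where
  "forces_clique_or_independent N p q \<longleftrightarrow> (\<forall>G :: nat pair_pre_digraph.
     pair_graph G \<and> N \<le> card (pverts G) \<longrightarrow> has_clique_or_independent G p q)"

lemma forces_clique_or_independent_binomial:
  assumes "(p + q - 2) choose (p - 1) \<le> N"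
  shows "forces_clique_or_independent N p q"
  unfolding forces_clique_or_independent_def
  using assms by (auto intro: erdos_szekeres pair_graph.pair_graphD_graph)

lemma ramsey_number_eq_Least:
  "ramsey_number p q = (LEAST N. 0 < N \<and> forces_clique_or_independent N p q)"
  by (simp add: ramsey_number_def forces_clique_or_independent_def has_clique_or_independent_def)

lemma forces_clique_or_independent_ramsey_number:
  "forces_clique_or_independent (ramsey_number p q) p q"
proof -
  have "0 < Suc ((p + q - 2) choose (p - 1)) \<and>
      forces_clique_or_independent (Suc ((p + q - 2) choose (p - 1))) p q"
    by (simp add: forces_clique_or_independent_binomial)
  then have "0 < ramsey_number p q \<and> forces_clique_or_independent (ramsey_number p q) p q"
    unfolding ramsey_number_eq_Least by (rule LeastI)
  then show ?thesis ..
qed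

lemma ramsey_number_le_binomial:
  assumes "0 < q"
  shows "ramsey_number p q \<le> (p + q - 2) choose (p - 1)"
  unfolding ramsey_number_eq_Least
  using assms by (intro Least_le) (simp add: forces_clique_or_independent_binomial)

definition relabel :: "('a \<Rightarrow> 'c) \<Rightarrow> ('a, 'b) pre_digraph \<Rightarrow> 'c pair_pre_digraph" where
  "relabel g G = \<lparr>pverts = g ` verts G, parcs = map_prod g g ` arcs_ends G\<rparr>"

lemma pverts_relabel [simp]: "pverts (relabel g G) = g ` verts G"
  by (simp add: relabel_def)

lemma (in wf_digraph) parcs_relabel_iff:
  assumes "inj_on g (verts G)" "u \<in> verts G" "v \<in> verts G"
  shows "(g u, g v) \<in> parcs (relabel g G) \<longleftrightarrow> u \<rightarrow>\<^bsub>G\<^esub> v"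
  using assms by (auto simp: relabel_def dest!: inj_onD[OF assms(1)])

lemma (in wf_digraph) clique_in_relabel_iff:
  assumes "inj_on g (verts G)" "S \<subseteq> verts G"
  shows "clique_in (relabel g G) (g ` S) \<longleftrightarrow> clique_in G S"
  using assms(2) inj_on_eq_iff[OF assms(1)]
  by (auto simp: clique_in_def subset_iff parcs_relabel_iff[OF assms(1)])

lemma (in wf_digraph) independent_in_relabel_iff:
  assumes "inj_on g (verts G)" "S \<subseteq> verts G"
  shows "independent_in (relabel g G) (g ` S) \<longleftrightarrow> independent_in G S"
  using assms(2) by (auto simp: independent_in_def subset_iff parcs_relabel_iff[OF assms(1)])

lemma (in graph) pair_graph_relabel:
  assumes "inj_on g (verts G)"
  shows "pair_graph (relabel g G)"
proof
  show "finite (parcs (relabel g G))"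
    using finite_arcs by (simp add: relabel_def arcs_ends_def)
  have parcs_image: "\<exists>u v. e = (g u, g v) \<and> u \<rightarrow>\<^bsub>G\<^esub> v" if "e \<in> parcs (relabel g G)" for e
    using that by (auto simp: relabel_def)
  show "symmetric (relabel g G)"
    unfolding symmetric_def with_proj_simps
  proof (rule symI)
    fix a b assume "(a, b) \<in> parcs (relabel g G)"
    then obtain u v where "a = g u" "b = g v" "v \<rightarrow>\<^bsub>G\<^esub> u"
      using parcs_image graph_symmetric by blast
    then show "(b, a) \<in> parcs (relabel g G)"
      by (simp add: parcs_relabel_iff[OF assms] adj_in_verts)
  qed
  fix e assume "e \<in> parcs (relabel g G)"
  then obtain u v where uv: "e = (g u, g v)" "u \<rightarrow>\<^bsub>G\<^esub> v"
    using parcs_image by blast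
  then show "fst e \<in> pverts (relabel g G)" "snd e \<in> pverts (relabel g G)"
    by (simp_all add: adj_in_verts)
  have "u \<noteq> v"
    using uv(2) no_loops by (auto simp: arcs_ends_conv)
  then show "fst e \<noteq> snd e"
    using uv inj_onD[OF assms] by (auto dest: adj_in_verts)
qed simp

lemma (in wf_digraph) has_clique_or_independent_relabelD:
  assumes inj: "inj_on g (verts G)" and "has_clique_or_independent (relabel g G) p q"
  shows "has_clique_or_independent G p q"
proof -
  have card_image_eq: "card (g ` S) = card S" if "S \<subseteq> verts G" for S
    by (rule card_image[OF inj_on_subset[OF inj that]])
  from assms(2) consider (clique) T where "clique_in (relabel g G) T" "card T = p"
    | (independent) T where "independent_in (relabel g G) T" "card T = q"
    unfolding has_clique_or_independent_def by blast
  then show ?thesis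
  proof cases
    case clique
    then obtain S where "S \<subseteq> verts G" "T = g ` S"
      by (auto simp: clique_in_def subset_image_iff)
    with clique show ?thesis
      using card_image_eq clique_in_relabel_iff[OF inj]
      unfolding has_clique_or_independent_def by metis
  next
    case independent
    then obtain S where "S \<subseteq> verts G" "T = g ` S"
      by (auto simp: independent_in_def subset_image_iff)
    with independent show ?thesis
      using card_image_eq independent_in_relabel_iff[OF inj]
      unfolding has_clique_or_independent_def by metis
  qed
qed

lemma (in graph) has_clique_or_independent_if_ramsey_number_le:
  assumes "ramsey_number p q \<le> card (verts G)"
  shows "has_clique_or_independent G p q"
proof -
  obtain g :: "'a \<Rightarrow> nat" where inj: "inj_on g (verts G)"
    using finite_imp_inj_to_nat_seg[OF finite_verts] by blast
  have "has_clique_or_independent (relabel g G) p q"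
    using forces_clique_or_independent_ramsey_number pair_graph_relabel[OF inj] assms
    by (simp add: forces_clique_or_independent_def card_image[OF inj])
  then show ?thesis
    by (rule has_clique_or_independent_relabelD[OF inj])
qed

lemma (in graph) card_verts_less_ramsey_number:
  assumes "clique_number G < p" and "independence_number G < q"
  shows "card (verts G) < ramsey_number p q"
proof (rule ccontr)
  assume "\<not> card (verts G) < ramsey_number p q"
  then have "has_clique_or_independent G p q"
    by (intro has_clique_or_independent_if_ramsey_number_le) simp
  moreover have "card S < p" if "clique_in G S" for S
    using card_le_clique_number[OF finite_verts that] assms(1) by (rule le_less_trans)
  moreover have "card S < q" if "independent_in G S" for S
    using card_le_independence_number[OF finite_verts that] assms(2) by (rule le_less_trans)
  ultimately show False
    unfolding has_clique_or_independent_def by blast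
qed

lemma ramsey_number_le_power: "ramsey_number (p + 1) (k + 1) \<le> (p + k) ^ k"
proof -
  have "ramsey_number (p + 1) (k + 1) \<le> (p + k) choose p"
    using ramsey_number_le_binomial[of "k + 1" "p + 1"] by simp
  also have "\<dots> = (p + k) choose k"
    using binomial_symmetric[of p "p + k"] by simp
  also have "\<dots> \<le> (p + k) ^ k"
    by (rule binomial_le_pow) simp
  finally show ?thesis .
qed

section \<open>Tree decompositions\<close>

lemma tree_decomposition_nodes:
  assumes "tree_decomposition G T X"
  shows "finite (pverts T)" "pverts T \<noteq> {}"
proof -
  have "pair_graph T" "Digraph_Component.connected T"
    using assms by (auto simp: tree_decomposition_def undirected_tree_def)
  then interpret pair_graph T
    by simp
  show "finite (pverts T)"
    by (rule pair_finite_verts)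
  show "pverts T \<noteq> {}"
    using \<open>Digraph_Component.connected T\<close> by (simp add: connected_conv)
qed

lemma tree_decomposition_bag_subset:
  assumes "tree_decomposition G T X" "t \<in> pverts T"
  shows "X t \<subseteq> verts G"
  using assms by (simp add: tree_decomposition_def)

lemma td_width_le_iff:
  assumes "tree_decomposition G T X"
  shows "td_width T X \<le> int n - 1 \<longleftrightarrow> (\<forall>t\<in>pverts T. card (X t) \<le> n)"
proof -
  have "td_width T X \<le> int n - 1 \<longleftrightarrow> Max ((\<lambda>t. card (X t)) ` pverts T) \<le> n"
    unfolding td_width_def by linarith
  then show ?thesis
    using tree_decomposition_nodes[OF assms] by simp
qed

lemma td_independence_number_le_iff:
  assumes "tree_decomposition G T X"
  shows "td_independence_number G T X \<le> n \<longleftrightarrow>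
    (\<forall>t\<in>pverts T. independence_number (G \<restriction> X t) \<le> n)"
  using tree_decomposition_nodes[OF assms] by (simp add: td_independence_number_def)

lemma connected_singleton:
  assumes "verts G = {v}"
  shows "Digraph_Component.connected G"
  using assms by (auto simp: connected_conv)

lemma (in wf_digraph) trivial_tree_decomposition:
  "tree_decomposition G \<lparr>pverts = {0}, parcs = {}\<rparr> (\<lambda>_. verts G)"
proof -
  let ?T = "\<lparr>pverts = {0::nat}, parcs = {}\<rparr>"
  have "pair_graph ?T"
    by unfold_locales (auto simp: symmetric_def)
  moreover have "\<not> (\<exists>c. pre_digraph.cycle ?T c \<and> 3 \<le> length c)"
    by (auto simp: pre_digraph.cycle_def pre_digraph.awalk_def)
  ultimately have "undirected_tree ?T"
    by (simp add: undirected_tree_def connected_singleton)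
  then show ?thesis
    unfolding tree_decomposition_def by (auto intro!: connected_singleton)
qed

lemma tree_decomposition_induced_subgraph:
  assumes decomp: "tree_decomposition G T X" and induced: "induced_subgraph H G"
  shows "tree_decomposition H T (\<lambda>t. X t \<inter> verts H)"
proof -
  have "{t \<in> pverts T. u \<in> X t \<inter> verts H} = {t \<in> pverts T. u \<in> X t}" if "u \<in> verts H" for u
    using that by auto
  then show ?thesis
    using decomp induced_subgraph_imp_subverts[OF induced]
    unfolding tree_decomposition_def induced_subgraph_dominates_iff[OF induced]
    by (simp add: subset_iff)
qed

lemma td_independence_number_le_card:
  assumes "finite (verts G)" and decomp: "tree_decomposition G T X"
  shows "td_independence_number G T X \<le> card (verts G)"
proof -
  have "independence_number (G \<restriction> X t) \<le> card (verts G)" if "t \<in> pverts T" for t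
  proof -
    have "finite (X t)" "card (X t) \<le> card (verts G)"
      using tree_decomposition_bag_subset[OF decomp that] assms(1)
      by (simp_all add: finite_subset card_mono)
    then show ?thesis
      using independence_number_le_card[of "G \<restriction> X t"] by simp
  qed
  then show ?thesis
    by (simp add: td_independence_number_le_iff[OF decomp])
qed

lemma treewidth_le_td_width:
  assumes "finite (verts G)" and "tree_decomposition G T X"
  shows "treewidth G \<le> td_width T X"
proof -
  have "td_width T' X' \<in> {-1..int (card (verts G)) - 1}"
    if decomp: "tree_decomposition G T' X'" for T' X'
  proof -
    have "td_width T' X' \<le> int (card (verts G)) - 1"
      unfolding td_width_le_iff[OF decomp]
      using assms(1) tree_decomposition_bag_subset[OF decomp] by (auto intro: card_mono)
    then show ?thesis
      by (simp add: td_width_def)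
  qed
  then have "{td_width T X | T X. tree_decomposition G T X} \<subseteq> {-1..int (card (verts G)) - 1}"
    by blast
  then have "finite {td_width T X | T X. tree_decomposition G T X}"
    by (rule finite_subset) simp
  then show ?thesis
    unfolding treewidth_def using assms(2) by (intro Min_le) auto
qed

lemma tree_independence_number_le_iff:
  assumes "wf_digraph G" and "finite (verts G)"
  shows "tree_independence_number G \<le> k \<longleftrightarrow>
    (\<exists>T X. tree_decomposition G T X \<and> td_independence_number G T X \<le> k)"
proof -
  have "{td_independence_number G T X | T X. tree_decomposition G T X} \<subseteq> {..card (verts G)}"
    using td_independence_number_le_card[OF assms(2)] by blast
  then have "finite {td_independence_number G T X | T X. tree_decomposition G T X}"
    by (rule finite_subset) simp
  then show ?thesis
    unfolding tree_independence_number_def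
    using wf_digraph.trivial_tree_decomposition[OF assms(1)] by (subst Min_le_iff) auto
qed

lemma td_independence_number_induced_subgraph_le:
  assumes "finite (verts G)"
    and decomp: "tree_decomposition G T X" and induced: "induced_subgraph H G"
  shows "td_independence_number H T (\<lambda>t. X t \<inter> verts H) \<le> td_independence_number G T X"
proof -
  have "independence_number (H \<restriction> (X t \<inter> verts H)) \<le> td_independence_number G T X"
    if node: "t \<in> pverts T" for t
  proof -
    have "finite (verts (G \<restriction> X t))"
      using tree_decomposition_bag_subset[OF decomp node] assms(1) by (simp add: finite_subset)
    then have "independence_number (H \<restriction> (X t \<inter> verts H)) \<le> independence_number (G \<restriction> X t)"
      using induced_subgraph_induce_Int[OF induced]
      by (rule independence_number_induced_subgraph_le)
    also have "\<dots> \<le> td_independence_number G T X"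
      using td_independence_number_le_iff[OF decomp, of "td_independence_number G T X"] node by simp
    finally show ?thesis .
  qed
  then show ?thesis
    by (simp add:
        td_independence_number_le_iff[OF tree_decomposition_induced_subgraph[OF decomp induced]])
qed

lemma tree_independence_number_induced_subgraph_le:
  assumes "finite (verts G)" and induced: "induced_subgraph H G"
  shows "tree_independence_number H \<le> tree_independence_number G"
proof -
  have wf: "wf_digraph G" "wf_digraph H"
    using induced by (auto simp: induced_subgraph_def subgraph_def)
  have finite_H: "finite (verts H)"
    using induced_subgraph_imp_subverts[OF induced] assms(1) by (rule finite_subset)
  obtain T X where decomp: "tree_decomposition G T X"
    and optimal: "td_independence_number G T X \<le> tree_independence_number G"
    using tree_independence_number_le_iff[OF wf(1) assms(1)] by blast
  have "td_independence_number H T (\<lambda>t. X t \<inter> verts H) \<le> tree_independence_number G"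
    using td_independence_number_induced_subgraph_le[OF assms(1) decomp induced] optimal
    by (rule order_trans)
  then show ?thesis
    using tree_independence_number_le_iff[OF wf(2) finite_H]
      tree_decomposition_induced_subgraph[OF decomp induced] by blast
qed

lemma (in graph) card_bag_less_ramsey_number:
  assumes decomp: "tree_decomposition G T X" and "td_independence_number G T X \<le> k"
    and node: "t \<in> pverts T"
  shows "card (X t) < ramsey_number (clique_number G + 1) (k + 1)"
proof -
  have induced: "induced_subgraph (G \<restriction> X t) G"
    using tree_decomposition_bag_subset[OF decomp node] by (rule induced_induce)
  interpret bag: graph "G \<restriction> X t"
    using induced by (rule graphI_induced)
  have "clique_number (G \<restriction> X t) < clique_number G + 1"
    using clique_number_induced_subgraph_le[OF finite_verts induced] by simp
  moreover have "independence_number (G \<restriction> X t) < k + 1"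
    using assms(2) node by (simp add: td_independence_number_le_iff[OF decomp] less_Suc_eq_le)
  ultimately show ?thesis
    using bag.card_verts_less_ramsey_number by simp
qed

lemma (in graph) treewidth_le_ramsey_number:
  assumes "tree_independence_number G \<le> k"
  shows "treewidth G \<le> int (ramsey_number (clique_number G + 1) (k + 1)) - 2"
proof -
  let ?R = "ramsey_number (clique_number G + 1) (k + 1)"
  obtain T X where decomp: "tree_decomposition G T X" and "td_independence_number G T X \<le> k"
    using assms tree_independence_number_le_iff[OF wf_digraph finite_verts] by blast
  then have bag: "card (X t) < ?R" if "t \<in> pverts T" for t
    using that by (rule card_bag_less_ramsey_number)
  moreover have "0 < ?R"
    using bag tree_decomposition_nodes(2)[OF decomp] by fastforce
  ultimately have "td_width T X \<le> int (?R - 1) - 1"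
    unfolding td_width_le_iff[OF decomp] by fastforce
  with \<open>0 < ?R\<close> treewidth_le_td_width[OF finite_verts decomp] show ?thesis
    by linarith
qed

lemma (in graph) treewidth_induced_subgraph_le_ramsey_number:
  assumes "tree_independence_number G \<le> k" and induced: "induced_subgraph H G"
  shows "treewidth H \<le> int (ramsey_number (clique_number H + 1) (k + 1)) - 2"
proof -
  interpret H: graph H
    using induced by (rule graphI_induced)
  show ?thesis
    using tree_independence_number_induced_subgraph_le[OF finite_verts induced] assms(1)
    by (intro H.treewidth_le_ramsey_number) (rule order_trans)
qed

theorem lemma3p2:
  fixes k :: nat and f :: "nat \<Rightarrow> int" and \<G> :: "('a, 'b) pre_digraph set"
  assumes "0 < k"
    and "\<G> = {G. graph G \<and> tree_independence_number G \<le> k}"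
    and "\<And>p. f p = int (ramsey_number (p + 1) (k + 1)) - 2"
  shows "tw_omega_bounded \<G> \<and>
         tw_omega_binding_function \<G> f \<and>
         (\<exists>P :: real poly. degree P = k \<and> (\<forall>p. real_of_int (f p) \<le> poly P (real p)))"
proof -
  have "tw_omega_binding_function \<G> f"
    unfolding tw_omega_binding_function_def assms(2,3)
    using graph.treewidth_induced_subgraph_le_ramsey_number by blast
  moreover have "real_of_int (f p) \<le> poly ([:real k, 1:] ^ k) (real p)" for p
  proof -
    have "real (ramsey_number (p + 1) (k + 1)) \<le> real ((p + k) ^ k)"
      using ramsey_number_le_power by (rule of_nat_mono)
    then show ?thesis
      by (simp add: assms(3) add.commute)
  qed
  moreover have "degree ([:real k, 1:] ^ k) = k"
    by (rule degree_linear_power)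
  ultimately show ?thesis
    unfolding tw_omega_bounded_def by blast
qed

end
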